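(* Let $D\subset\mathbb{R}^d$ be nonempty, closed and convex, let $\sigma>0$, and let $g\in C^1(\mathbb{R}^d)$ satisfy: (A1) $g$ is $m$-strongly convex for some $m>0$, and $\nabla g$ is globally $L$-Lipschitz, i.e. $\|\nabla g(x)-\nabla g(y)\|\le L\|x-y\|$ for all $x,y\in\mathbb{R}^d$; (A2) there exists $R>0$ such that $\sigma^2+\|\nabla g(x)\|^2\le R(1+\|x\|^2)$ for all $x\in\mathbb{R}^d$. Let $\pi$ denote the unique invariant probability measure of the reflected Langevin SDE in $D$, $$X_t=X_0+\int_0^t\sigma\,dW_s-\int_0^t\nabla g(X_s)\,ds+K_t,\qquad X_t\in D,$$ and for each integer $n\ge1$ let $\pi^n$ denote the unique invariant probability measure of the penalized SDE $$X^n_t=X_0+\int_0^t\sigma\,dW_s-\int_0^t\nabla g(X^n_s)\,ds-n\int_0^t\big(X^n_s-\Pi(X^n_s)\big)\,ds .$$ Then there exist constants $C>0$ and $\delta>0$, independent of $n$, such that for all $n\ge1$ $$W_2(\pi,\pi^n)\le C\,n^{-\delta}.$$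
   Context: $W_t$ is a standard $d$-dimensional Brownian motion and $\Pi:\mathbb{R}^d\to D$ is the metric projection onto $D$. $\dist(x,D)$ denotes the Euclidean distance to $D$, and $W_2$ is the Wasserstein distance of order 2: $W_2(\mu,\nu)^2=\inf\int\|x-y\|^2\,d\zeta(x,y)$ over couplings $\zeta$ of $\mu,\nu$. $m$-strongly convex means $g(y)\ge g(x)+\langle\nabla g(x),y-x\rangle+\frac m2\|y-x\|^2$ for all $x,y\in\mathbb{R}^d$. Reflected SDE: $X_0\in D$, $X$ is a continuous adapted process with values in $D$, and $K$ is a continuous adapted process of bounded variation with $K_0=0$ whose total variation $\|K\|$ increases only when $X_t\in\partial D$, the reflection being normal, i.e. $dK_t$ points along an inward normal direction of $D$ at $X_t$ ($d\|K\|_t$-a.e.). It is a standing assumption that this SDE is well posed and has a unique invariant probability measure $\pi$; $\pi$ is the Gibbs measure on $D$ with density proportional to $e^{-\frac{2}{\sigma^2}g(x)}\mathbf 1_{\{x\in D\}}$. Penalized SDE: with $f_n(x)=g(x)+\frac n2\dist^2(x,D)$ the penalized SDE is $dX^n_t=-\nabla f_n(X^n_t)\,dt+\sigma\,dW_t$ on $\mathbb{R}^d$, and $\pi^n$ has density proportional to $e^{-\frac2{\sigma^2}f_n(x)}$ on $\mathbb{R}^d$. *)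

theory Defs
  imports "HOL-Probability.Probability"
begin

section \<open>Assumptions on the potential\<close>

text \<open>\<open>G\<close> plays the role of \<open>\<nabla>g\<close>; it is tied to \<open>g\<close> by \<^const>\<open>gderiv\<close>.\<close>

definition C1_with_gradient :: "((real ^ 'd) \<Rightarrow> real) \<Rightarrow> ((real ^ 'd) \<Rightarrow> (real ^ 'd)) \<Rightarrow> bool" where
  "C1_with_gradient g G \<longleftrightarrow> (\<forall>x. GDERIV g x :> G x) \<and> continuous_on UNIV G"

definition strongly_convex ::
  "real \<Rightarrow> ((real ^ 'd) \<Rightarrow> real) \<Rightarrow> ((real ^ 'd) \<Rightarrow> (real ^ 'd)) \<Rightarrow> bool" where
  "strongly_convex m g G \<longleftrightarrow>
     (\<forall>x y. g y \<ge> g x + G x \<bullet> (y - x) + m / 2 * (norm (y - x))\<^sup>2)"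


section \<open>Wasserstein distance of order 2\<close>

definition couplings :: "(real ^ 'd) measure \<Rightarrow> (real ^ 'd) measure \<Rightarrow> ((real ^ 'd) \<times> (real ^ 'd)) measure set" where
  "couplings \<mu> \<nu> = {\<zeta>. sets \<zeta> = sets (borel \<Otimes>\<^sub>M borel) \<and>
                       distr \<zeta> borel fst = \<mu> \<and> distr \<zeta> borel snd = \<nu>}"

definition ennreal_sqrt :: "ennreal \<Rightarrow> ennreal" where
  "ennreal_sqrt a = (if a = \<infinity> then \<infinity> else ennreal (sqrt (enn2real a)))"

definition wasserstein2 :: "(real ^ 'd) measure \<Rightarrow> (real ^ 'd) measure \<Rightarrow> ennreal" where
  "wasserstein2 \<mu> \<nu> =
     ennreal_sqrt (INF \<zeta>\<in>couplings \<mu> \<nu>. \<integral>\<^sup>+ p. ennreal ((norm (fst p - snd p))\<^sup>2) \<partial>\<zeta>)"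


section \<open>Brownian motion\<close>

text \<open>All processes are indexed by \<^typ>\<open>real\<close>, but only their values at times \<open>t \<ge> 0\<close> matter.\<close>

definition adapted :: "(real \<Rightarrow> 'w measure) \<Rightarrow> (real \<Rightarrow> 'w \<Rightarrow> real ^ 'd) \<Rightarrow> bool" where
  "adapted F X \<longleftrightarrow> (\<forall>t\<ge>0. X t \<in> borel_measurable (F t))"

definition brownian_motion ::
  "'w measure \<Rightarrow> (real \<Rightarrow> 'w measure) \<Rightarrow> (real \<Rightarrow> 'w \<Rightarrow> real ^ 'd) \<Rightarrow> bool" where
  "brownian_motion M F W \<longleftrightarrow>
     prob_space M \<and> filtration (space M) F \<and> (\<forall>t. subalgebra M (F t)) \<and> adapted F W \<and>
     (AE \<omega> in M. W 0 \<omega> = 0 \<and> continuous_on {0..} (\<lambda>t. W t \<omega>)) \<and>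
     (\<forall>s t. 0 \<le> s \<and> s < t \<longrightarrow>
        distr M borel (\<lambda>\<omega>. W t \<omega> - W s \<omega>) =
          density lborel (\<lambda>x. ennreal (\<Prod>i\<in>UNIV. normal_density 0 (sqrt (t - s)) (x $ i))) \<and>
        prob_space.indep_set M (sets (F s))
          (sets (vimage_algebra (space M) (\<lambda>\<omega>. W t \<omega> - W s \<omega>) borel)))"


section \<open>The reflected and the penalized SDE\<close>

definition total_variation :: "(real \<Rightarrow> real ^ 'd) \<Rightarrow> real \<Rightarrow> real \<Rightarrow> ennreal" where
  "total_variation k a b =
     (SUP (N, p) \<in> {(N :: nat, p :: nat \<Rightarrow> real). mono p \<and> range p \<subseteq> {a..b}}.
        \<Sum>i<N. ennreal (norm (k (p (Suc i)) - k (p i))))"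

text \<open>The Stieltjes measure \<open>d\<parallel>k\<parallel>\<close> on the half line, for \<open>k\<close> continuous and of locally bounded
  variation; the distribution function is extended by \<open>0\<close> to negative times.\<close>

definition variation_measure :: "(real \<Rightarrow> real ^ 'd) \<Rightarrow> real measure" where
  "variation_measure k = interval_measure (\<lambda>t. enn2real (total_variation k 0 (max 0 t)))"

text \<open>\<open>\<nu>\<close> is the density \<open>dk / d\<parallel>k\<parallel>\<close>. Its almost-everywhere condition says that \<open>\<parallel>k\<parallel>\<close> increases
  only when \<open>x\<close> is on the boundary, and that \<open>dk\<close> then points along a unit inward normal of \<open>D\<close>.\<close>

definition normal_reflection ::
  "(real ^ 'd) set \<Rightarrow> (real \<Rightarrow> real ^ 'd) \<Rightarrow> (real \<Rightarrow> real ^ 'd) \<Rightarrow> bool" where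
  "normal_reflection D x k \<longleftrightarrow>
     continuous_on {0..} k \<and> k 0 = 0 \<and> (\<forall>t\<ge>0. total_variation k 0 t < \<infinity>) \<and>
     (\<exists>\<nu>\<in>borel_measurable borel.
        (AE s in variation_measure k. x s \<in> frontier D \<and> norm (\<nu> s) = 1 \<and>
            (\<forall>y\<in>D. \<nu> s \<bullet> (y - x s) \<ge> 0)) \<and>
        (\<forall>t\<ge>0. k t = (LINT s:{0..t}|variation_measure k. \<nu> s)))"

text \<open>As \<open>\<sigma>\<close> is constant and \<open>W\<close> starts at \<open>0\<close>, the stochastic integral of \<open>\<sigma>\<close> over \<open>[0,t]\<close> is
  \<open>\<sigma> W\<^sub>t\<close>.\<close>

definition reflected_solution ::
  "'w measure \<Rightarrow> (real \<Rightarrow> 'w measure) \<Rightarrow> (real \<Rightarrow> 'w \<Rightarrow> real ^ 'd) \<Rightarrow> real \<Rightarrow>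
   ((real ^ 'd) \<Rightarrow> (real ^ 'd)) \<Rightarrow> (real ^ 'd) set \<Rightarrow>
   (real \<Rightarrow> 'w \<Rightarrow> real ^ 'd) \<Rightarrow> (real \<Rightarrow> 'w \<Rightarrow> real ^ 'd) \<Rightarrow> bool" where
  "reflected_solution M F W \<sigma> G D X K \<longleftrightarrow>
     adapted F X \<and> adapted F K \<and>
     (AE \<omega> in M.
        continuous_on {0..} (\<lambda>t. X t \<omega>) \<and> (\<forall>t\<ge>0. X t \<omega> \<in> D) \<and>
        normal_reflection D (\<lambda>t. X t \<omega>) (\<lambda>t. K t \<omega>) \<and>
        (\<forall>t\<ge>0. X t \<omega> = X 0 \<omega> + \<sigma> *\<^sub>R W t \<omega> - integral {0..t} (\<lambda>s. G (X s \<omega>)) + K t \<omega>))"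

definition penalized_solution ::
  "'w measure \<Rightarrow> (real \<Rightarrow> 'w measure) \<Rightarrow> (real \<Rightarrow> 'w \<Rightarrow> real ^ 'd) \<Rightarrow> real \<Rightarrow>
   ((real ^ 'd) \<Rightarrow> (real ^ 'd)) \<Rightarrow> (real ^ 'd) set \<Rightarrow> nat \<Rightarrow>
   (real \<Rightarrow> 'w \<Rightarrow> real ^ 'd) \<Rightarrow> bool" where
  "penalized_solution M F W \<sigma> G D n X \<longleftrightarrow>
     adapted F X \<and>
     (AE \<omega> in M.
        continuous_on {0..} (\<lambda>t. X t \<omega>) \<and>
        (\<forall>t\<ge>0. X t \<omega> = X 0 \<omega> + \<sigma> *\<^sub>R W t \<omega> - integral {0..t} (\<lambda>s. G (X s \<omega>))
                 - real n *\<^sub>R integral {0..t} (\<lambda>s. X s \<omega> - closest_point D (X s \<omega>))))"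

text \<open>Strong existence and pathwise uniqueness for every initial value \<open>X\<^sub>0 \<in> D\<close>.\<close>

definition reflected_well_posed ::
  "'w measure \<Rightarrow> (real \<Rightarrow> 'w measure) \<Rightarrow> (real \<Rightarrow> 'w \<Rightarrow> real ^ 'd) \<Rightarrow> real \<Rightarrow>
   ((real ^ 'd) \<Rightarrow> (real ^ 'd)) \<Rightarrow> (real ^ 'd) set \<Rightarrow> bool" where
  "reflected_well_posed M F W \<sigma> G D \<longleftrightarrow>
     (\<forall>\<xi>\<in>borel_measurable (F 0). (AE \<omega> in M. \<xi> \<omega> \<in> D) \<longrightarrow>
        (\<exists>X K. reflected_solution M F W \<sigma> G D X K \<and> (AE \<omega> in M. X 0 \<omega> = \<xi> \<omega>))) \<and>
     (\<forall>X K X' K'. reflected_solution M F W \<sigma> G D X K \<longrightarrow> reflected_solution M F W \<sigma> G D X' K' \<longrightarrow>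
        (AE \<omega> in M. X 0 \<omega> = X' 0 \<omega>) \<longrightarrow>
        (AE \<omega> in M. \<forall>t\<ge>0. X t \<omega> = X' t \<omega> \<and> K t \<omega> = K' t \<omega>))"


section \<open>Invariant measures\<close>

text \<open>\<open>Sol\<close> is the set of solutions of an SDE driven by a Brownian motion on \<open>M\<close>. For an SDE with
  (pathwise) unique solutions, \<open>transition_law M Sol x t\<close> is the law \<open>P\<^sub>t(x, -)\<close> at time \<open>t\<close> of the
  solution started at the point \<open>x\<close>. The measure \<open>\<mu>\<close> is invariant iff \<open>\<mu> P\<^sub>t = \<mu>\<close> for all \<open>t \<ge> 0\<close>;
  \<open>S\<close> is the state space.\<close>

definition transition_law ::
  "'w measure \<Rightarrow> (real \<Rightarrow> 'w \<Rightarrow> real ^ 'd) set \<Rightarrow> real ^ 'd \<Rightarrow> real \<Rightarrow> (real ^ 'd) measure" where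
  "transition_law M Sol x t =
     (THE \<nu>. \<exists>X\<in>Sol. (AE \<omega> in M. X 0 \<omega> = x) \<and> \<nu> = distr M borel (X t))"

definition invariant_probability ::
  "'w measure \<Rightarrow> (real \<Rightarrow> 'w \<Rightarrow> real ^ 'd) set \<Rightarrow> (real ^ 'd) set \<Rightarrow> (real ^ 'd) measure \<Rightarrow> bool" where
  "invariant_probability M Sol S \<mu> \<longleftrightarrow>
     prob_space \<mu> \<and> sets \<mu> = sets borel \<and> (AE x in \<mu>. x \<in> S) \<and>
     (\<forall>t\<ge>0. \<forall>A\<in>sets borel. emeasure \<mu> A = (\<integral>\<^sup>+ x. emeasure (transition_law M Sol x t) A \<partial>\<mu>))"

definition unique_invariant_probability ::
  "'w measure \<Rightarrow> (real \<Rightarrow> 'w \<Rightarrow> real ^ 'd) set \<Rightarrow> (real ^ 'd) set \<Rightarrow> (real ^ 'd) measure \<Rightarrow> bool" where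
  "unique_invariant_probability M Sol S \<mu> \<longleftrightarrow>
     invariant_probability M Sol S \<mu> \<and> (\<forall>\<mu>'. invariant_probability M Sol S \<mu>' \<longrightarrow> \<mu>' = \<mu>)"

definition reflected_solutions where
  "reflected_solutions M F W \<sigma> G D = {X. \<exists>K. reflected_solution M F W \<sigma> G D X K}"

definition penalized_solutions where
  "penalized_solutions M F W \<sigma> G D n = {X. penalized_solution M F W \<sigma> G D n X}"


section \<open>Gibbs measures\<close>

definition density_proportional_to :: "(real ^ 'd) measure \<Rightarrow> ((real ^ 'd) \<Rightarrow> real) \<Rightarrow> bool" where
  "density_proportional_to \<mu> h \<longleftrightarrow> (\<exists>c>0. \<mu> = density lborel (\<lambda>x. ennreal (c * h x)))"

definition penalized_potential ::
  "((real ^ 'd) \<Rightarrow> real) \<Rightarrow> (real ^ 'd) set \<Rightarrow> nat \<Rightarrow> (real ^ 'd) \<Rightarrow> real" where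
  "penalized_potential g D n x = g x + real n / 2 * (infdist x D)\<^sup>2"

end

theory Submission
  imports Defs
begin

text \<open>
  Both invariant measures have explicit Gibbs densities, and the proof compares these. Write
  \<open>h = exp (- (2 / \<sigma>\<^sup>2) g)\<close>. Up to normalisation, \<open>\<pi>\<close> has density
  \<open>h 1\<^sub>D\<close> and \<open>\<pi>\<^sub>n\<close> has density \<open>h w\<^sub>n\<close> with \<open>w\<^sub>n(x) = exp (- (n / \<sigma>\<^sup>2) dist(x, D)\<^sup>2)\<close>. As the penalty
  vanishes on \<open>D\<close>, \<open>\<pi>\<close> is exactly \<open>\<pi>\<^sub>n\<close> conditioned on \<open>D\<close>. Draw \<open>x\<close> from \<open>\<pi>\<close> and \<open>y\<close> from \<open>\<pi>\<^sub>n\<close>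
  independently; the pair \<open>(y, y)\<close> if \<open>y \<in> D\<close> and \<open>(x, y)\<close> otherwise is then a coupling, and it costs
  nothing on \<open>D\<close> (\<open>wasserstein2_conditioned_le\<close>). It remains to see that
  \<open>\<integral>\<^bsub>-D\<^esub> (1 + \<parallel>y - z\<parallel>\<^sup>2) d\<pi>\<^sub>n(y)\<close> decays polynomially in \<open>n\<close> for some point \<open>z\<close>.

  Since \<open>\<pi>\<close> is a probability measure with a density supported by \<open>D\<close>, the convex set \<open>D\<close> contains a
  ball \<open>B(z, r)\<close> with \<open>r > 0\<close> (\<open>interior_nonempty_if_carries_density\<close>). By strong convexity of \<open>g\<close>,
  \<open>h(x) (1 + \<parallel>x - z\<parallel>\<^sup>2)\<close> is dominated by a Gaussian \<open>E\<close> centred at this same \<open>z\<close>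
  (\<open>strongly_convex_gibbs_le_gaussian\<close>). Compare \<open>D\<close> with its dilation \<open>D\<^sub>s\<close> by the factor
  \<open>1 + s\<close> about \<open>z\<close>. Outside \<open>D\<^sub>s\<close> the distance to \<open>D\<close> is at least \<open>s r\<close>, so the penalty
  factor is small there (\<open>infdist_ge_outside_dilation\<close>). The shell \<open>D\<^sub>s - D\<close> has small Gaussian mass:
  \<open>E\<close> decreases along rays from \<open>z\<close>, so a change of variables gives
  \<open>\<integral>\<^bsub>D\<^sub>s\<^esub> E \<le> (1 + s)\<^sup>d \<integral>\<^bsub>D\<^esub> E\<close> (\<open>gaussian_shell_le\<close>). With \<open>s = n\<^bsup>-1/4\<^esup>\<close> both contributions are at
  most of order \<open>n\<^bsup>-1/4\<^esup>\<close> (\<open>gaussian_penalized_le\<close>), so the squared distance is at most of order \<open>n\<^bsup>-1/4\<^esup>\<close>, and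
  \<open>\<delta> = 1/8\<close> works.
\<close>

section \<open>Gaussian mass near and far from a convex set\<close>

lemma nn_integral_gaussian_finite:
  fixes z :: "'a::euclidean_space"
  assumes "b > 0"
  shows "(\<integral>\<^sup>+x. ennreal (exp (- b * (norm (x - z))\<^sup>2)) \<partial>lborel) < \<infinity>"
proof -
  have one_dim: "(\<integral>\<^sup>+x. ennreal (exp (- b * (x - w)\<^sup>2)) \<partial>lborel) < \<infinity>" for w :: real
  proof -
    have "exp (- b * (x - w)\<^sup>2) = sqrt (pi / b) * normal_density w (1 / sqrt (2 * b)) x" for x
      using assms by (simp add: normal_density_def power_divide real_sqrt_divide real_sqrt_mult field_simps)
    then have "(\<integral>\<^sup>+x. ennreal (exp (- b * (x - w)\<^sup>2)) \<partial>lborel) =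
        ennreal (\<integral>x. sqrt (pi / b) * normal_density w (1 / sqrt (2 * b)) x \<partial>lborel)"
      using assms by (simp add: nn_integral_eq_integral)
    then show ?thesis by simp
  qed
  have "exp (- b * (norm (x - z))\<^sup>2) = (\<Prod>i\<in>Basis. exp (- b * (x \<bullet> i - z \<bullet> i)\<^sup>2))" for x
    unfolding power2_norm_eq_inner euclidean_inner[of "x - z" "x - z"]
    by (simp add: exp_sum[symmetric] inner_diff_left sum_distrib_left sum_negf power2_eq_square)
  then have "(\<integral>\<^sup>+x. ennreal (exp (- b * (norm (x - z))\<^sup>2)) \<partial>lborel)
      = (\<integral>\<^sup>+x. (\<Prod>i\<in>Basis. ennreal (exp (- b * (x \<bullet> i - z \<bullet> i)\<^sup>2))) \<partial>lborel)"
    by (simp add: prod_ennreal)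
  also have "\<dots> = (\<Prod>i\<in>Basis. \<integral>\<^sup>+x. ennreal (exp (- b * (x - z \<bullet> i)\<^sup>2)) \<partial>lborel)"
    by (rule nn_integral_lborel_prod) auto
  also have "\<dots> < \<infinity>"
    using one_dim unfolding infinity_ennreal_def less_top[symmetric]
    by (simp only: ennreal_prod_eq_top) blast
  finally show ?thesis .
qed

text \<open>If \<open>x\<close> were within distance less than \<open>s r\<close> of some \<open>d \<in> D\<close>, then \<open>w = z + (x - d) / s\<close> would lie
  in the ball, and \<open>z + (x - z) / (1 + s)\<close> is the convex combination of \<open>d\<close> and \<open>w\<close> with weights
  \<open>1 / (1 + s)\<close> and \<open>s / (1 + s)\<close>.\<close>

lemma infdist_ge_outside_dilation:
  fixes D :: "'a::euclidean_space set"
  assumes "convex D" and ball: "ball z r \<subseteq> D" and "r > 0" "s > 0"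
    and out: "z + (1 / (1 + s)) *\<^sub>R (x - z) \<notin> D"
  shows "s * r \<le> infdist x D"
proof (rule ccontr)
  assume "\<not> s * r \<le> infdist x D"
  moreover have "z \<in> D" using ball \<open>r > 0\<close> by auto
  then have "D \<noteq> {}" by blast
  ultimately obtain d where d: "d \<in> D" "dist x d < s * r"
    using cINF_less_iff[of D "dist x" "s * r"] by (auto simp: infdist_notempty)
  define w where "w = z + (1 / s) *\<^sub>R (x - d)"
  have "dist z w < r"
    using d \<open>s > 0\<close> by (simp add: w_def dist_norm divide_less_eq mult.commute)
  then have "w \<in> D" using ball by auto
  have "(1 / (1 + s)) *\<^sub>R d + (s / (1 + s)) *\<^sub>R w \<in> D"
    using \<open>s > 0\<close> by (intro convexD[OF \<open>convex D\<close> d(1) \<open>w \<in> D\<close>]) (auto simp: field_simps)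
  also have "(1 / (1 + s)) *\<^sub>R d + (s / (1 + s)) *\<^sub>R w = z + (1 / (1 + s)) *\<^sub>R (x - z)"
  proof -
    have "(1 / (1 + s)) *\<^sub>R d + (s / (1 + s)) *\<^sub>R w = (1 / (1 + s)) *\<^sub>R (x + s *\<^sub>R z)"
      using \<open>s > 0\<close> by (simp add: w_def algebra_simps)
    also have "\<dots> = (1 / (1 + s)) *\<^sub>R ((1 + s) *\<^sub>R z + (x - z))"
      by (simp add: algebra_simps)
    also have "\<dots> = z + (1 / (1 + s)) *\<^sub>R (x - z)"
      using \<open>s > 0\<close> by (simp only: scaleR_right_distrib scaleR_scaleR) simp
    finally show ?thesis .
  qed
  finally show False using out by simp
qed

lemma one_plus_power_le:
  fixes s :: real
  assumes "0 \<le> s" "s \<le> 1"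
  shows "(1 + s) ^ k \<le> 1 + (2 ^ k - 1) * s"
proof (induction k)
  case (Suc k)
  have "(2 ^ k - 1) * (s * s) \<le> (2 ^ k - 1) * s"
    using assms by (intro mult_left_mono) (auto simp: mult_left_le)
  moreover have "(1 + s) * (1 + s) ^ k \<le> (1 + s) * (1 + (2 ^ k - 1) * s)"
    using Suc assms by (intro mult_left_mono) auto
  ultimately show ?case by (simp add: algebra_simps)
qed simp

text \<open>The indicated set is the shell \<open>D\<^sub>s - D\<close>, where \<open>D\<^sub>s\<close> is the dilation of \<open>D\<close> about \<open>z\<close> by the
  factor \<open>1 + s\<close>. Substituting the dilation for \<open>x\<close> turns the integral over \<open>D\<^sub>s\<close> into one over \<open>D\<close>, at
  the price of the Jacobian \<open>(1 + s)\<^sup>d\<close>, and only decreases the integrand because the Gaussian is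
  centred at the centre of the dilation. Subtracting the integral over \<open>D \<subseteq> D\<^sub>s\<close>
  leaves \<open>(1 + s)\<^sup>d - 1 \<le> 2\<^sup>d s\<close> times the Gaussian mass of \<open>D\<close>.\<close>

lemma gaussian_shell_le:
  fixes D :: "'a::euclidean_space set"
  assumes [measurable]: "D \<in> sets borel" and "convex D" "z \<in> D" "b > 0" "0 < s" "s \<le> 1"
  defines "E \<equiv> \<lambda>x. ennreal (exp (- b * (norm (x - z))\<^sup>2))"
  shows "(\<integral>\<^sup>+x. E x * indicator {x. x \<notin> D \<and> z + (1 / (1 + s)) *\<^sub>R (x - z) \<in> D} x \<partial>lborel)
     \<le> ennreal (2 ^ DIM('a) * s) * (\<integral>\<^sup>+x. E x \<partial>lborel)"
proof -
  define p where "p x = z + (1 / (1 + s)) *\<^sub>R (x - z)" for x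
  have [measurable]: "p \<in> borel_measurable borel" unfolding p_def by measurable
  have [measurable]: "E \<in> borel_measurable borel" unfolding E_def by measurable
  let ?A = "\<integral>\<^sup>+x. E x * indicator {x. x \<notin> D \<and> p x \<in> D} x \<partial>lborel"
  let ?B = "\<integral>\<^sup>+x. E x * indicator D x \<partial>lborel"
  have B_le: "?B \<le> (\<integral>\<^sup>+x. E x \<partial>lborel)"
    by (intro nn_integral_mono) (auto simp: indicator_def)
  have "(\<integral>\<^sup>+x. E x \<partial>lborel) < \<infinity>"
    unfolding E_def using \<open>b > 0\<close> by (rule nn_integral_gaussian_finite)
  with B_le have fin: "?B < \<infinity>" by (rule le_less_trans)
  have p_in: "p x \<in> D" if "x \<in> D" for x
  proof -
    have "(s / (1 + s)) *\<^sub>R z + (1 / (1 + s)) *\<^sub>R x \<in> D"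
      using \<open>0 < s\<close> by (intro convexD[OF \<open>convex D\<close> \<open>z \<in> D\<close> that]) (auto simp: field_simps)
    also have "(s / (1 + s)) *\<^sub>R z + (1 / (1 + s)) *\<^sub>R x = p x"
    proof -
      have weight: "s / (1 + s) = 1 - 1 / (1 + s)" using \<open>0 < s\<close> by (simp add: field_simps)
      show ?thesis unfolding p_def weight
        by (simp only: scaleR_left_diff_distrib scaleR_right_diff_distrib scaleR_one) simp
    qed
    finally show ?thesis .
  qed
  have "?A + ?B = (\<integral>\<^sup>+x. E x * indicator {x. x \<notin> D \<and> p x \<in> D} x + E x * indicator D x \<partial>lborel)"
    by (rule nn_integral_add[symmetric]) auto
  also have "\<dots> = (\<integral>\<^sup>+x. E x * indicator D (p x) \<partial>lborel)"
    using p_in by (intro nn_integral_cong) (auto simp: indicator_def)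
  also have "\<dots> = ennreal ((1 + s) ^ DIM('a)) *
      (\<integral>\<^sup>+x. E (- s *\<^sub>R z + (1 + s) *\<^sub>R x) * indicator D (p (- s *\<^sub>R z + (1 + s) *\<^sub>R x)) \<partial>lborel)"
    using \<open>0 < s\<close>
    by (subst lborel_affine[of "1 + s" "- s *\<^sub>R z"])
       (auto simp: nn_integral_density nn_integral_distr nn_integral_cmult)
  also have "(\<integral>\<^sup>+x. E (- s *\<^sub>R z + (1 + s) *\<^sub>R x) * indicator D (p (- s *\<^sub>R z + (1 + s) *\<^sub>R x)) \<partial>lborel) \<le> ?B"
  proof (intro nn_integral_mono)
    fix x :: 'a
    have shift: "- s *\<^sub>R z + (1 + s) *\<^sub>R x - z = (1 + s) *\<^sub>R (x - z)" by (simp add: algebra_simps)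
    have "norm (x - z) \<le> norm ((1 + s) *\<^sub>R (x - z))"
      using \<open>0 < s\<close> by (simp add: mult_right_le_one_le distrib_right)
    then have "b * (norm (x - z))\<^sup>2 \<le> b * (norm ((1 + s) *\<^sub>R (x - z)))\<^sup>2"
      using \<open>b > 0\<close> by (intro mult_left_mono power_mono) auto
    then have "E (- s *\<^sub>R z + (1 + s) *\<^sub>R x) \<le> E x"
      unfolding E_def shift by (intro ennreal_leI) simp
    moreover have "p (- s *\<^sub>R z + (1 + s) *\<^sub>R x) = x"
      unfolding p_def shift using \<open>0 < s\<close> by simp
    ultimately show "E (- s *\<^sub>R z + (1 + s) *\<^sub>R x) * indicator D (p (- s *\<^sub>R z + (1 + s) *\<^sub>R x))
        \<le> E x * indicator D x"
      by (simp add: mult_right_mono)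
  qed
  finally have "?A + ?B \<le> ennreal ((1 + s) ^ DIM('a)) * ?B"
    by (simp add: mult_left_mono)
  also have "\<dots> \<le> ennreal (2 ^ DIM('a) * s + 1) * ?B"
    using one_plus_power_le[of s "DIM('a)"] assms by (intro mult_right_mono ennreal_leI) (auto simp: algebra_simps)
  also have "\<dots> = ennreal (2 ^ DIM('a) * s) * ?B + ?B"
    using \<open>0 < s\<close> by (simp add: distrib_right)
  finally have "?A \<le> ennreal (2 ^ DIM('a) * s) * ?B"
    using fin by (auto simp: add.commute[of _ ?B] ennreal_add_left_cancel_le)
  also have "\<dots> \<le> ennreal (2 ^ DIM('a) * s) * (\<integral>\<^sup>+x. E x \<partial>lborel)"
    using B_le by (rule mult_left_mono) simp
  finally show ?thesis unfolding p_def .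
qed

text \<open>Split the complement of \<open>D\<close> at the dilation by \<open>1 + s\<close>: the shell contributes \<open>2\<^sup>d s\<close>, the rest
  at most \<open>exp (- n a (s r)\<^sup>2)\<close>. The choice \<open>s = n\<^bsup>-1/4\<^esup>\<close> makes \<open>n s\<^sup>2 = 1 / s\<^sup>2\<close>, and the crude bound
  \<open>exp (- y) \<le> 1 / y\<close> already makes the second term \<open>O(s\<^sup>2)\<close>.\<close>

lemma gaussian_penalized_le:
  fixes D :: "'a::euclidean_space set"
  assumes "closed D" "convex D" and ball: "ball z r \<subseteq> D" and pos: "r > 0" "b > 0" "a > 0"
    and "n \<ge> (1::nat)"
  defines "E \<equiv> \<lambda>x. ennreal (exp (- b * (norm (x - z))\<^sup>2))"
  shows "(\<integral>\<^sup>+x. E x * ennreal (exp (- (real n * a * (infdist x D)\<^sup>2))) * indicator (- D) x \<partial>lborel)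
     \<le> ennreal ((2 ^ DIM('a) + 1 / (a * r\<^sup>2)) * real n powr (- (1/4))) * (\<integral>\<^sup>+x. E x \<partial>lborel)"
proof -
  define s where "s = real n powr (- (1/4))"
  have s: "0 < s" "s \<le> 1"
  proof -
    show "0 < s" using \<open>n \<ge> 1\<close> by (simp add: s_def)
    have "s \<le> real n powr 0" unfolding s_def using \<open>n \<ge> 1\<close> by (intro powr_mono) auto
    then show "s \<le> 1" using \<open>n \<ge> 1\<close> by simp
  qed
  have ns2: "real n * s\<^sup>2 = 1 / s\<^sup>2"
  proof -
    have "s\<^sup>2 * s\<^sup>2 = real n powr (- 1)"
      by (simp add: s_def power2_eq_square powr_add[symmetric])
    also have "\<dots> = 1 / real n" using \<open>n \<ge> 1\<close> by (simp add: powr_minus_divide)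
    finally show ?thesis using s \<open>n \<ge> 1\<close> by (simp add: field_simps)
  qed
  have far: "exp (- (real n * a * (s * r)\<^sup>2)) \<le> s / (a * r\<^sup>2)"
  proof -
    let ?y = "real n * a * (s * r)\<^sup>2"
    have y: "?y = a * r\<^sup>2 / s\<^sup>2"
    proof -
      have "?y = a * r\<^sup>2 * (real n * s\<^sup>2)" by (simp add: power_mult_distrib)
      then show ?thesis by (simp add: ns2)
    qed
    have "?y > 0" using pos s \<open>n \<ge> 1\<close> by simp
    have "?y \<le> exp ?y" using exp_ge_add_one_self[of ?y] by linarith
    have "exp (- ?y) = 1 / exp ?y" by (simp add: exp_minus inverse_eq_divide)
    also have "\<dots> \<le> 1 / ?y"
      by (rule frac_le[OF _ _ \<open>?y > 0\<close> \<open>?y \<le> exp ?y\<close>]) simp_all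
    also have "\<dots> = s * s / (a * r\<^sup>2)" unfolding y by (simp add: power2_eq_square)
    also have "\<dots> \<le> s / (a * r\<^sup>2)"
      using pos s by (intro divide_right_mono) (auto simp: mult_le_one mult_left_le)
    finally show ?thesis .
  qed
  have [measurable]: "D \<in> sets borel" using \<open>closed D\<close> by auto
  have [measurable]: "E \<in> borel_measurable borel" unfolding E_def by measurable
  have "z \<in> D" using ball \<open>r > 0\<close> by auto
  let ?S = "{x. x \<notin> D \<and> z + (1 / (1 + s)) *\<^sub>R (x - z) \<in> D}"
  have "(\<integral>\<^sup>+x. E x * ennreal (exp (- (real n * a * (infdist x D)\<^sup>2))) * indicator (- D) x \<partial>lborel)
      \<le> (\<integral>\<^sup>+x. E x * indicator ?S x + ennreal (s / (a * r\<^sup>2)) * E x \<partial>lborel)"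
  proof (intro nn_integral_mono)
    fix x
    show "E x * ennreal (exp (- (real n * a * (infdist x D)\<^sup>2))) * indicator (- D) x
        \<le> E x * indicator ?S x + ennreal (s / (a * r\<^sup>2)) * E x"
    proof (cases "z + (1 / (1 + s)) *\<^sub>R (x - z) \<in> D")
      case True
      have "E x * ennreal (exp (- (real n * a * (infdist x D)\<^sup>2))) \<le> E x * 1"
        using pos by (intro mult_left_mono) auto
      then have "E x * ennreal (exp (- (real n * a * (infdist x D)\<^sup>2))) * indicator (- D) x
          \<le> E x * indicator ?S x"
        using True by (auto simp: indicator_def)
      then show ?thesis by (rule order_trans) simp
    next
      case False
      have "s * r \<le> infdist x D"
        by (rule infdist_ge_outside_dilation) (use False assms s in auto)
      then have "real n * a * (s * r)\<^sup>2 \<le> real n * a * (infdist x D)\<^sup>2"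
        using pos s by (intro mult_left_mono power_mono) auto
      then have "exp (- (real n * a * (infdist x D)\<^sup>2)) \<le> s / (a * r\<^sup>2)"
        by (intro order_trans[OF _ far]) simp
      then have "E x * ennreal (exp (- (real n * a * (infdist x D)\<^sup>2)))
          \<le> E x * ennreal (s / (a * r\<^sup>2))"
        by (intro mult_left_mono ennreal_leI) auto
      then show ?thesis
        using False by (auto simp: indicator_def mult.commute)
    qed
  qed
  also have "\<dots> = (\<integral>\<^sup>+x. E x * indicator ?S x \<partial>lborel)
      + ennreal (s / (a * r\<^sup>2)) * (\<integral>\<^sup>+x. E x \<partial>lborel)"
    by (subst nn_integral_add) (auto simp: nn_integral_cmult)
  also have "\<dots> \<le> ennreal (2 ^ DIM('a) * s) * (\<integral>\<^sup>+x. E x \<partial>lborel)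
      + ennreal (s / (a * r\<^sup>2)) * (\<integral>\<^sup>+x. E x \<partial>lborel)"
    unfolding E_def
    by (intro add_right_mono gaussian_shell_le) (use assms s \<open>z \<in> D\<close> in auto)
  also have "\<dots> = ennreal ((2 ^ DIM('a) + 1 / (a * r\<^sup>2)) * s) * (\<integral>\<^sup>+x. E x \<partial>lborel)"
  proof -
    have "ennreal (2 ^ DIM('a) * s) + ennreal (s / (a * r\<^sup>2)) = ennreal (2 ^ DIM('a) * s + s / (a * r\<^sup>2))"
      using pos s by (intro ennreal_plus[symmetric]) auto
    also have "2 ^ DIM('a) * s + s / (a * r\<^sup>2) = (2 ^ DIM('a) + 1 / (a * r\<^sup>2)) * s"
      by (simp add: distrib_right)
    finally show ?thesis by (simp only: distrib_right[symmetric])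
  qed
  finally show ?thesis unfolding s_def .
qed

section \<open>Coupling a measure with its conditioning\<close>

lemma ennreal_sqrt_mono: "x \<le> y \<Longrightarrow> ennreal_sqrt x \<le> ennreal_sqrt y"
  by (cases x; cases y) (auto simp: ennreal_sqrt_def top_unique)

lemma ennreal_sqrt_ennreal: "y \<ge> 0 \<Longrightarrow> ennreal_sqrt (ennreal y) = ennreal (sqrt y)"
  by (simp add: ennreal_sqrt_def)

text \<open>The hypothesis \<open>cond\<close> says that \<open>\<mu>\<close> is \<open>\<nu>\<close> conditioned on \<open>D\<close>. The coupling resamples \<open>y\<close>
  from \<open>\<mu>\<close> when \<open>y \<notin> D\<close>: the map \<open>f\<close> below sends an independent pair \<open>(x, y)\<close> to \<open>(y, y)\<close> if \<open>y \<in> D\<close>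
  and leaves it alone otherwise. Its first component lies in \<open>A\<close> with probability
  \<open>\<nu>(A \<inter> D) + \<nu>(-D) \<mu>(A) = \<nu>(D) \<mu>(A) + \<nu>(-D) \<mu>(A) = \<mu>(A)\<close>.\<close>

lemma wasserstein2_conditioned_le:
  fixes \<mu> \<nu> :: "(real ^ 'd) measure"
  assumes "prob_space \<mu>" "prob_space \<nu>" and [measurable_cong]: "sets \<mu> = sets borel" "sets \<nu> = sets borel"
    and [measurable]: "D \<in> sets borel"
    and cond: "\<And>A. A \<in> sets borel \<Longrightarrow> emeasure \<nu> (A \<inter> D) = emeasure \<nu> D * emeasure \<mu> A"
  shows "wasserstein2 \<mu> \<nu> \<le>
    ennreal_sqrt (\<integral>\<^sup>+y. (\<integral>\<^sup>+x. ennreal ((norm (x - y))\<^sup>2) \<partial>\<mu>) * indicator (- D) y \<partial>\<nu>)"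
proof -
  interpret \<mu>: prob_space \<mu> by fact
  interpret \<nu>: prob_space \<nu> by fact
  interpret P: pair_sigma_finite \<mu> \<nu> ..
  define f :: "(real ^ 'd) \<times> (real ^ 'd) \<Rightarrow> (real ^ 'd) \<times> (real ^ 'd)"
    where "f p = (if snd p \<in> D then (snd p, snd p) else p)" for p
  have f[measurable]: "f \<in> (\<mu> \<Otimes>\<^sub>M \<nu>) \<rightarrow>\<^sub>M (borel \<Otimes>\<^sub>M borel)"
    unfolding f_def by measurable
  define \<zeta> where "\<zeta> = distr (\<mu> \<Otimes>\<^sub>M \<nu>) (borel \<Otimes>\<^sub>M borel) f"
  have sp: "space \<mu> = UNIV" "space \<nu> = UNIV"
    using sets_eq_imp_space_eq[OF assms(3)] sets_eq_imp_space_eq[OF assms(4)] by auto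
  have fst: "distr \<zeta> borel fst = \<mu>"
  proof (rule measure_eqI)
    fix A assume "A \<in> sets (distr \<zeta> borel fst)"
    then have A[measurable]: "A \<in> sets borel" by simp
    have "emeasure (distr \<zeta> borel fst) A
        = emeasure (\<mu> \<Otimes>\<^sub>M \<nu>) ((fst \<circ> f) -` A \<inter> space (\<mu> \<Otimes>\<^sub>M \<nu>))"
      unfolding \<zeta>_def by (subst distr_distr) (auto simp: emeasure_distr)
    also have "(fst \<circ> f) -` A \<inter> space (\<mu> \<Otimes>\<^sub>M \<nu>) = (UNIV \<times> (A \<inter> D)) \<union> (A \<times> (- D))"
      by (auto simp: f_def space_pair_measure sp split: if_splits)
    also have "emeasure (\<mu> \<Otimes>\<^sub>M \<nu>) \<dots> = emeasure \<nu> (A \<inter> D) + emeasure \<mu> A * emeasure \<nu> (- D)"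
    proof (subst plus_emeasure[symmetric])
      show "UNIV \<times> (A \<inter> D) \<in> sets (\<mu> \<Otimes>\<^sub>M \<nu>)" "A \<times> (- D) \<in> sets (\<mu> \<Otimes>\<^sub>M \<nu>)"
        by (auto simp: assms(3,4))
      show "emeasure (\<mu> \<Otimes>\<^sub>M \<nu>) (UNIV \<times> (A \<inter> D)) + emeasure (\<mu> \<Otimes>\<^sub>M \<nu>) (A \<times> (- D)) =
        emeasure \<nu> (A \<inter> D) + emeasure \<mu> A * emeasure \<nu> (- D)"
        using \<mu>.emeasure_space_1
        by (subst (1 2) \<nu>.emeasure_pair_measure_Times) (auto simp: assms(3,4) sp)
    qed auto
    also have "\<dots> = (emeasure \<nu> D + emeasure \<nu> (- D)) * emeasure \<mu> A"
      by (simp add: cond distrib_left mult.commute)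
    also have "emeasure \<nu> D + emeasure \<nu> (- D) = 1"
      using \<nu>.emeasure_space_1 by (subst plus_emeasure) (auto simp: assms(4) sp)
    finally show "emeasure (distr \<zeta> borel fst) A = emeasure \<mu> A" by simp
  qed (simp add: assms(3))
  have "distr \<zeta> borel snd = distr (\<mu> \<Otimes>\<^sub>M \<nu>) borel (snd \<circ> f)"
    unfolding \<zeta>_def by (subst distr_distr) auto
  also have "snd \<circ> f = snd" by (auto simp: f_def)
  also have "distr (\<mu> \<Otimes>\<^sub>M \<nu>) borel snd = \<nu>"
  proof (rule measure_eqI)
    fix A assume "A \<in> sets (distr (\<mu> \<Otimes>\<^sub>M \<nu>) borel snd)"
    then have A[measurable]: "A \<in> sets borel" by simp
    have "emeasure (distr (\<mu> \<Otimes>\<^sub>M \<nu>) borel snd) A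
        = emeasure (\<mu> \<Otimes>\<^sub>M \<nu>) (snd -` A \<inter> space (\<mu> \<Otimes>\<^sub>M \<nu>))"
      by (subst emeasure_distr) auto
    also have "snd -` A \<inter> space (\<mu> \<Otimes>\<^sub>M \<nu>) = UNIV \<times> A"
      by (auto simp: space_pair_measure sp)
    also have "emeasure (\<mu> \<Otimes>\<^sub>M \<nu>) (UNIV \<times> A) = emeasure \<nu> A"
      using \<mu>.emeasure_space_1
      by (subst \<nu>.emeasure_pair_measure_Times) (auto simp: assms(3,4) sp)
    finally show "emeasure (distr (\<mu> \<Otimes>\<^sub>M \<nu>) borel snd) A = emeasure \<nu> A" .
  qed (simp add: assms(4))
  finally have "distr \<zeta> borel snd = \<nu>" .
  with fst have "\<zeta> \<in> couplings \<mu> \<nu>" by (simp add: couplings_def \<zeta>_def)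
  then have "(INF \<zeta>\<in>couplings \<mu> \<nu>. \<integral>\<^sup>+ p. ennreal ((norm (fst p - snd p))\<^sup>2) \<partial>\<zeta>)
      \<le> (\<integral>\<^sup>+ p. ennreal ((norm (fst p - snd p))\<^sup>2) \<partial>\<zeta>)"
    by (rule INF_lower)
  also have "\<dots> = (\<integral>\<^sup>+ p. ennreal ((norm (fst p - snd p))\<^sup>2) * indicator (- D) (snd p) \<partial>(\<mu> \<Otimes>\<^sub>M \<nu>))"
    unfolding \<zeta>_def
    by (subst nn_integral_distr) (auto simp: f_def indicator_def intro!: nn_integral_cong)
  also have "\<dots> = (\<integral>\<^sup>+y. (\<integral>\<^sup>+x. ennreal ((norm (x - y))\<^sup>2) * indicator (- D) y \<partial>\<mu>) \<partial>\<nu>)"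
    by (subst P.nn_integral_snd[symmetric]) auto
  also have "\<dots> = (\<integral>\<^sup>+y. (\<integral>\<^sup>+x. ennreal ((norm (x - y))\<^sup>2) \<partial>\<mu>) * indicator (- D) y \<partial>\<nu>)"
    by (intro nn_integral_cong) (simp add: nn_integral_multc)
  finally have "(INF \<zeta>\<in>couplings \<mu> \<nu>. \<integral>\<^sup>+ p. ennreal ((norm (fst p - snd p))\<^sup>2) \<partial>\<zeta>)
      \<le> (\<integral>\<^sup>+y. (\<integral>\<^sup>+x. ennreal ((norm (x - y))\<^sup>2) \<partial>\<mu>) * indicator (- D) y \<partial>\<nu>)" .
  then show ?thesis unfolding wasserstein2_def by (rule ennreal_sqrt_mono)
qed

section \<open>Gibbs measures of strongly convex potentials\<close>

text \<open>Strong convexity at \<open>z\<close> bounds the exponent above by an affine function of \<open>u = \<parallel>y - z\<parallel>\<close> minus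
  \<open>(\<beta> m / 2) u\<^sup>2\<close>. One quarter of the quadratic term absorbs the linear term, another quarter absorbs the
  factor \<open>1 + u\<^sup>2\<close>, and half of it, \<open>(\<beta> m / 4) u\<^sup>2\<close>, is left. The centre \<open>z\<close> is arbitrary, so it can be
  chosen in the interior of \<open>D\<close> rather than at the minimiser of \<open>g\<close>.\<close>

lemma strongly_convex_gibbs_le_gaussian:
  fixes z :: "real ^ 'd"
  assumes "strongly_convex m g G" "m > 0" "\<beta> > 0"
  obtains C where "C > 0"
    "\<And>y. exp (- \<beta> * g y) * (1 + (norm (y - z))\<^sup>2) \<le> C * exp (- (\<beta> * m / 4) * (norm (y - z))\<^sup>2)"
proof -
  define k where "k = \<beta> * m"
  define q where "q = \<beta> * norm (G z)"
  have "k > 0" using assms by (simp add: k_def)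
  have "exp (- \<beta> * g y) * (1 + (norm (y - z))\<^sup>2)
      \<le> (exp (- \<beta> * g z + 2 * q\<^sup>2 / k) * (1 + 8 / k)) * exp (- (k / 4) * (norm (y - z))\<^sup>2)" for y
  proof -
    define u where "u = norm (y - z)"
    have "g z + G z \<bullet> (y - z) + m / 2 * u\<^sup>2 \<le> g y"
      using assms unfolding strongly_convex_def u_def by blast
    moreover have "- (norm (G z) * u) \<le> G z \<bullet> (y - z)"
      using Cauchy_Schwarz_ineq2[of "G z" "y - z"] by (simp add: u_def abs_le_iff)
    ultimately have "g z - norm (G z) * u + m / 2 * u\<^sup>2 \<le> g y" by linarith
    then have "\<beta> * (g z - norm (G z) * u + m / 2 * u\<^sup>2) \<le> \<beta> * g y"
      using \<open>\<beta> > 0\<close> by (intro mult_left_mono) auto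
    then have 1: "- \<beta> * g y \<le> - \<beta> * g z + q * u - k / 2 * u\<^sup>2"
      by (simp add: q_def k_def algebra_simps)
    have 2: "q * u \<le> 2 * q\<^sup>2 / k + k / 8 * u\<^sup>2"
    proof -
      have "0 \<le> (4 * q - k * u)\<^sup>2 / (8 * k)" using \<open>k > 0\<close> by simp
      also have "\<dots> = 2 * q\<^sup>2 / k + k / 8 * u\<^sup>2 - q * u"
        using \<open>k > 0\<close> by (simp add: power2_eq_square field_simps)
      finally show ?thesis by simp
    qed
    have 3: "1 + u\<^sup>2 \<le> (1 + 8 / k) * exp (k / 8 * u\<^sup>2)"
    proof -
      have "1 + u\<^sup>2 \<le> (1 + 8 / k) * (1 + k / 8 * u\<^sup>2)"
        using \<open>k > 0\<close> by (simp add: field_simps)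
      also have "\<dots> \<le> (1 + 8 / k) * exp (k / 8 * u\<^sup>2)"
        using \<open>k > 0\<close> exp_ge_add_one_self[of "k / 8 * u\<^sup>2"] by (intro mult_left_mono) auto
      finally show ?thesis .
    qed
    have "exp (- \<beta> * g y) * (1 + u\<^sup>2)
        \<le> exp (- \<beta> * g z + (2 * q\<^sup>2 / k + k / 8 * u\<^sup>2) - k / 2 * u\<^sup>2) * ((1 + 8 / k) * exp (k / 8 * u\<^sup>2))"
      using 1 2 3 by (intro mult_mono) auto
    also have "\<dots> = (exp (- \<beta> * g z + 2 * q\<^sup>2 / k) * (1 + 8 / k)) *
        (exp (- (3 * k / 8) * u\<^sup>2) * exp (k / 8 * u\<^sup>2))"
    proof -
      have "- \<beta> * g z + (2 * q\<^sup>2 / k + k / 8 * u\<^sup>2) - k / 2 * u\<^sup>2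
          = (- \<beta> * g z + 2 * q\<^sup>2 / k) + - (3 * k / 8) * u\<^sup>2"
        by (simp add: algebra_simps)
      then show ?thesis by (simp only: exp_add mult_ac)
    qed
    also have "exp (- (3 * k / 8) * u\<^sup>2) * exp (k / 8 * u\<^sup>2) = exp (- (k / 4) * u\<^sup>2)"
      by (simp add: exp_add[symmetric] algebra_simps)
    finally show ?thesis by (simp add: u_def)
  qed
  then show ?thesis
    using \<open>k > 0\<close> by (intro that[of "exp (- \<beta> * g z + 2 * q\<^sup>2 / k) * (1 + 8 / k)"])
      (auto simp: k_def add_pos_pos)
qed


text \<open>A convex set with empty interior is Lebesgue-null.\<close>

lemma interior_nonempty_if_carries_density:
  fixes D :: "'a::euclidean_space set"
  assumes "convex D" "closed D" and prob: "prob_space (density lborel f)"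
    and [measurable]: "f \<in> borel_measurable borel" and "\<And>x. x \<notin> D \<Longrightarrow> f x = 0"
  shows "interior D \<noteq> {}"
proof
  assume "interior D = {}"
  then have "negligible D" using \<open>convex D\<close> by (simp add: negligible_convex_interior)
  then have "D \<in> null_sets lborel"
    using \<open>closed D\<close> by (simp add: negligible_iff_null_sets null_sets_completion_iff)
  moreover have "{x \<in> space lborel. f x \<noteq> 0} \<subseteq> D" using assms(5) by auto
  ultimately have "AE x in lborel. f x = 0" by (rule AE_I')
  then have "(\<integral>\<^sup>+x. f x \<partial>lborel) = 0"
    by (simp add: nn_integral_0_iff_AE)
  moreover have "(\<integral>\<^sup>+x. f x \<partial>lborel) = 1"
    using prob_space.emeasure_space_1[OF prob] by (simp add: emeasure_density)
  ultimately show False by simp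
qed

text \<open>On \<open>D\<close> the two densities are proportional with ratio \<open>k / c\<close>. This ratio is therefore the
  \<open>\<nu>\<close>-mass of \<open>D\<close>, which is at most \<open>1\<close>; so the normalising constants \<open>k\<close> of a family of such \<open>\<nu>\<close> are
  bounded uniformly by \<open>c\<close>.\<close>

lemma density_conditioned:
  fixes h f :: "'a::euclidean_space \<Rightarrow> real"
  assumes [measurable]: "D \<in> sets borel" "h \<in> borel_measurable borel" "f \<in> borel_measurable borel"
    and pos: "c > 0" "k > 0" and agree: "\<And>x. x \<in> D \<Longrightarrow> f x = h x"
    and \<mu>: "\<mu> = density lborel (\<lambda>x. ennreal (c * (h x * indicator D x)))" "prob_space \<mu>"
    and \<nu>: "\<nu> = density lborel (\<lambda>x. ennreal (k * f x))" "prob_space \<nu>"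
  shows "k \<le> c"
    and "A \<in> sets borel \<Longrightarrow> emeasure \<nu> (A \<inter> D) = emeasure \<nu> D * emeasure \<mu> A"
proof -
  have scale: "emeasure \<nu> (A \<inter> D) = ennreal (k / c) * emeasure \<mu> A"
    if [measurable]: "A \<in> sets borel" for A
  proof -
    have "emeasure \<nu> (A \<inter> D) =
        (\<integral>\<^sup>+x. ennreal (k / c) * (ennreal (c * (h x * indicator D x)) * indicator A x) \<partial>lborel)"
      unfolding \<nu>(1) using pos
      by (subst emeasure_density)
         (auto intro!: nn_integral_cong simp: indicator_def agree ennreal_mult'[symmetric])
    also have "\<dots> = ennreal (k / c) * emeasure \<mu> A"
      unfolding \<mu>(1) by (subst emeasure_density) (auto simp: nn_integral_cmult)
    finally show ?thesis .
  qed
  have "emeasure \<mu> UNIV = 1"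
    using prob_space.emeasure_space_1[OF \<mu>(2)] by (simp add: \<mu>(1))
  with scale[of UNIV] have D: "emeasure \<nu> D = ennreal (k / c)" by simp
  then have "ennreal (k / c) \<le> 1"
    using prob_space.emeasure_le_1[OF \<nu>(2), of D] by simp
  then show "k \<le> c" using pos by (simp add: divide_le_eq ennreal_le_1)
  show "emeasure \<nu> (A \<inter> D) = emeasure \<nu> D * emeasure \<mu> A" if "A \<in> sets borel"
    using scale[OF that] D by simp
qed

lemma norm_diff_squared_le:
  fixes x y z :: "'a::real_inner"
  shows "(norm (x - y))\<^sup>2 \<le> 2 * (norm (x - z))\<^sup>2 + 2 * (norm (y - z))\<^sup>2"
proof -
  have "norm (x - y) \<le> norm (x - z) + norm (y - z)"
    using norm_triangle_ineq4[of "x - z" "y - z"] by simp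
  then have "(norm (x - y))\<^sup>2 \<le> (norm (x - z) + norm (y - z))\<^sup>2"
    by (rule power_mono) simp
  also have "\<dots> \<le> 2 * (norm (x - z))\<^sup>2 + 2 * (norm (y - z))\<^sup>2"
    using sum_squares_bound[of "norm (x - z)" "norm (y - z)"] by (simp add: power2_sum)
  finally show ?thesis .
qed

text \<open>The bound is uniform in \<open>n\<close>: besides \<open>D\<close>, \<open>h\<close> and the constants that describe them, it involves
  only the normalising constant \<open>c\<close> of \<open>\<mu>\<close>, which dominates the constant \<open>k\<close> of \<open>\<nu>\<close>.
  The cost of the coupling is the integral of \<open>\<parallel>x - y\<parallel>\<^sup>2 \<le> 2 \<parallel>x - z\<parallel>\<^sup>2 + 2 \<parallel>y - z\<parallel>\<^sup>2\<close> over \<open>y \<notin> D\<close>; the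
  second moment of \<open>\<mu>\<close> about \<open>z\<close> is at most \<open>c C \<kappa>\<close>, and the \<open>y\<close>-part is controlled
  by the Gaussian estimate outside \<open>D\<close>.\<close>

lemma wasserstein2_penalized_gibbs_le:
  fixes D :: "(real ^ 'd) set" and h :: "real ^ 'd \<Rightarrow> real"
  assumes D: "closed D" "convex D" and ball: "ball z r \<subseteq> D"
    and pos: "r > 0" "b > 0" "a > 0" "c > 0" "k > 0" and "n \<ge> 1"
    and [measurable]: "h \<in> borel_measurable borel" and h_nonneg: "\<And>x. h x \<ge> 0"
    and h_le: "\<And>x. h x * (1 + (norm (x - z))\<^sup>2) \<le> C * exp (- b * (norm (x - z))\<^sup>2)" and "C > 0"
    and \<kappa>: "(\<integral>\<^sup>+x. ennreal (exp (- b * (norm (x - z))\<^sup>2)) \<partial>lborel) = ennreal \<kappa>" "\<kappa> \<ge> 0"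
    and \<mu>: "\<mu> = density lborel (\<lambda>x. ennreal (c * (h x * indicator D x)))" "prob_space \<mu>"
    and \<nu>: "\<nu> = density lborel (\<lambda>x. ennreal (k * (h x * exp (- (real n * a * (infdist x D)\<^sup>2)))))"
           "prob_space \<nu>"
  shows "wasserstein2 \<mu> \<nu> \<le>
    ennreal (sqrt (2 * (1 + c * C * \<kappa>) * (c * C * \<kappa>) * (2 ^ CARD('d) + 1 / (a * r\<^sup>2))) * real n powr (- (1/8)))"
proof -
  define A where "A = c * C * \<kappa>"
  have "A \<ge> 0" using pos \<open>C > 0\<close> \<kappa> by (simp add: A_def)
  define w where "w x = exp (- (real n * a * (infdist x D)\<^sup>2))" for x
  define q where "q = (2 ^ CARD('d) + 1 / (a * r\<^sup>2)) * real n powr (- (1/4))"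
  have "q \<ge> 0" using pos by (simp add: q_def)
  let ?E = "\<lambda>x. ennreal (exp (- b * (norm (x - z))\<^sup>2))"
  have [measurable]: "D \<in> sets borel" using D by auto
  have [measurable]: "(\<lambda>x. infdist x D) \<in> borel_measurable borel"
    by (intro borel_measurable_continuous_onI continuous_intros)
  have [measurable]: "w \<in> borel_measurable borel" unfolding w_def by measurable
  have w_D: "w x = 1" if "x \<in> D" for x using that by (simp add: w_def)
  note \<nu>' = \<nu>[folded w_def]
  have kc: "k \<le> c"
    by (rule density_conditioned(1)[OF _ _ _ \<open>c > 0\<close> \<open>k > 0\<close> _ \<mu> \<nu>']) (simp_all add: w_D)
  have cond: "emeasure \<nu> (B \<inter> D) = emeasure \<nu> D * emeasure \<mu> B" if "B \<in> sets borel" for B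
    by (rule density_conditioned(2)[OF _ _ _ \<open>c > 0\<close> \<open>k > 0\<close> _ \<mu> \<nu>' that]) (simp_all add: w_D)
  have sets: "sets \<mu> = sets borel" "sets \<nu> = sets borel" by (simp_all add: \<mu>(1) \<nu>(1))
  note [measurable_cong] = sets
  have moment_\<mu>: "(\<integral>\<^sup>+x. ennreal ((norm (x - z))\<^sup>2) \<partial>\<mu>) \<le> ennreal A"
  proof -
    have "(\<integral>\<^sup>+x. ennreal ((norm (x - z))\<^sup>2) \<partial>\<mu>)
        = (\<integral>\<^sup>+x. ennreal (c * (h x * indicator D x)) * ennreal ((norm (x - z))\<^sup>2) \<partial>lborel)"
      unfolding \<mu>(1) by (rule nn_integral_density) auto
    also have "\<dots> \<le> (\<integral>\<^sup>+x. ennreal (c * C) * ?E x \<partial>lborel)"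
    proof (intro nn_integral_mono)
      fix x
      have "h x * indicator D x * (norm (x - z))\<^sup>2 \<le> h x * 1 * (1 + (norm (x - z))\<^sup>2)"
        using h_nonneg[of x] by (intro mult_mono) (auto simp: indicator_def)
      also have "\<dots> \<le> C * exp (- b * (norm (x - z))\<^sup>2)" using h_le[of x] by simp
      finally have "c * (h x * indicator D x * (norm (x - z))\<^sup>2) \<le> c * (C * exp (- b * (norm (x - z))\<^sup>2))"
        using pos by (intro mult_left_mono) auto
      then show "ennreal (c * (h x * indicator D x)) * ennreal ((norm (x - z))\<^sup>2) \<le> ennreal (c * C) * ?E x"
        by (subst (1 2) ennreal_mult''[symmetric]) (auto intro!: ennreal_leI simp: mult_ac)
    qed
    also have "\<dots> = ennreal A"
      using pos \<open>C > 0\<close> \<kappa> by (simp add: nn_integral_cmult A_def ennreal_mult')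
    finally show ?thesis .
  qed
  have moment_\<nu>: "(\<integral>\<^sup>+y. ennreal (1 + (norm (y - z))\<^sup>2) * indicator (- D) y \<partial>\<nu>) \<le> ennreal (A * q)"
  proof -
    have "(\<integral>\<^sup>+y. ennreal (1 + (norm (y - z))\<^sup>2) * indicator (- D) y \<partial>\<nu>)
        = (\<integral>\<^sup>+y. ennreal (k * (h y * w y)) * (ennreal (1 + (norm (y - z))\<^sup>2) * indicator (- D) y) \<partial>lborel)"
      unfolding \<nu>'(1) by (rule nn_integral_density) auto
    also have "\<dots> \<le> (\<integral>\<^sup>+y. ennreal (c * C) * (?E y * ennreal (w y) * indicator (- D) y) \<partial>lborel)"
    proof (intro nn_integral_mono)
      fix y
      have "w y \<ge> 0" by (simp add: w_def)
      have "k * w y * (h y * (1 + (norm (y - z))\<^sup>2)) \<le> c * w y * (C * exp (- b * (norm (y - z))\<^sup>2))"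
      proof (rule mult_mono)
        show "k * w y \<le> c * w y" using kc \<open>w y \<ge> 0\<close> by (rule mult_right_mono)
      qed (use pos h_le[of y] h_nonneg[of y] \<open>w y \<ge> 0\<close> in auto)
      then have "ennreal (k * (h y * w y)) * ennreal (1 + (norm (y - z))\<^sup>2)
          \<le> ennreal (c * C) * (?E y * ennreal (w y))"
        using pos \<open>C > 0\<close> \<open>w y \<ge> 0\<close>
        by (simp add: ennreal_mult''[symmetric] ennreal_mult'[symmetric] del: ennreal_plus)
           (auto intro!: ennreal_leI simp: mult_ac)
      then show "ennreal (k * (h y * w y)) * (ennreal (1 + (norm (y - z))\<^sup>2) * indicator (- D) y)
          \<le> ennreal (c * C) * (?E y * ennreal (w y) * indicator (- D) y)"
        by (auto simp: indicator_def mult.assoc)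
    qed
    also have "\<dots> = ennreal (c * C) * (\<integral>\<^sup>+y. ?E y * ennreal (w y) * indicator (- D) y \<partial>lborel)"
      by (rule nn_integral_cmult) auto
    also have "\<dots> \<le> ennreal (c * C) * (ennreal q * ennreal \<kappa>)"
      using gaussian_penalized_le[OF D ball \<open>r > 0\<close> \<open>b > 0\<close> \<open>a > 0\<close> \<open>n \<ge> 1\<close>] \<kappa>(1)
      by (intro mult_left_mono) (auto simp: w_def q_def)
    also have "\<dots> = ennreal (A * q)"
      using pos \<open>C > 0\<close> \<open>q \<ge> 0\<close> \<kappa>(2) by (simp add: A_def ennreal_mult'[symmetric] mult_ac)
    finally show ?thesis .
  qed
  have inner: "(\<integral>\<^sup>+x. ennreal ((norm (x - y))\<^sup>2) \<partial>\<mu>) \<le> ennreal (2 * (1 + A)) * ennreal (1 + (norm (y - z))\<^sup>2)" for y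
  proof -
    have "(\<integral>\<^sup>+x. ennreal ((norm (x - y))\<^sup>2) \<partial>\<mu>)
        \<le> (\<integral>\<^sup>+x. 2 * ennreal ((norm (x - z))\<^sup>2) + ennreal (2 * (norm (y - z))\<^sup>2) \<partial>\<mu>)"
    proof (intro nn_integral_mono)
      fix x
      have "ennreal ((norm (x - y))\<^sup>2) \<le> ennreal (2 * (norm (x - z))\<^sup>2 + 2 * (norm (y - z))\<^sup>2)"
        by (intro ennreal_leI norm_diff_squared_le)
      then show "ennreal ((norm (x - y))\<^sup>2) \<le> 2 * ennreal ((norm (x - z))\<^sup>2) + ennreal (2 * (norm (y - z))\<^sup>2)"
        by (simp add: ennreal_mult')
    qed
    also have "\<dots> = 2 * (\<integral>\<^sup>+x. ennreal ((norm (x - z))\<^sup>2) \<partial>\<mu>) + ennreal (2 * (norm (y - z))\<^sup>2)"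
      using prob_space.emeasure_space_1[OF \<mu>(2)] by (simp add: nn_integral_add nn_integral_cmult)
    also have "\<dots> \<le> 2 * ennreal A + ennreal (2 * (norm (y - z))\<^sup>2)"
      using moment_\<mu> by (intro add_right_mono mult_left_mono) auto
    also have "\<dots> = ennreal (2 * A + 2 * (norm (y - z))\<^sup>2)"
      using \<open>A \<ge> 0\<close> by (simp add: ennreal_mult')
    also have "\<dots> \<le> ennreal (2 * (1 + A) * (1 + (norm (y - z))\<^sup>2))"
      using \<open>A \<ge> 0\<close> by (intro ennreal_leI) (simp add: algebra_simps)
    finally show ?thesis using \<open>A \<ge> 0\<close> by (simp add: ennreal_mult' del: ennreal_plus)
  qed
  have "(\<integral>\<^sup>+y. (\<integral>\<^sup>+x. ennreal ((norm (x - y))\<^sup>2) \<partial>\<mu>) * indicator (- D) y \<partial>\<nu>)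
      \<le> (\<integral>\<^sup>+y. ennreal (2 * (1 + A)) * (ennreal (1 + (norm (y - z))\<^sup>2) * indicator (- D) y) \<partial>\<nu>)"
    using inner by (intro nn_integral_mono) (auto simp: indicator_def)
  also have "\<dots> = ennreal (2 * (1 + A)) * (\<integral>\<^sup>+y. ennreal (1 + (norm (y - z))\<^sup>2) * indicator (- D) y \<partial>\<nu>)"
    by (rule nn_integral_cmult) measurable
  also have "\<dots> \<le> ennreal (2 * (1 + A)) * ennreal (A * q)"
    using moment_\<nu> by (intro mult_left_mono) auto
  also have "\<dots> = ennreal (2 * (1 + A) * (A * q))"
    using \<open>A \<ge> 0\<close> by (simp add: ennreal_mult' del: ennreal_plus)
  finally have cost: "(\<integral>\<^sup>+y. (\<integral>\<^sup>+x. ennreal ((norm (x - y))\<^sup>2) \<partial>\<mu>) * indicator (- D) y \<partial>\<nu>)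
      \<le> ennreal (2 * (1 + A) * (A * q))" .
  have "wasserstein2 \<mu> \<nu> \<le>
      ennreal_sqrt (\<integral>\<^sup>+y. (\<integral>\<^sup>+x. ennreal ((norm (x - y))\<^sup>2) \<partial>\<mu>) * indicator (- D) y \<partial>\<nu>)"
    by (rule wasserstein2_conditioned_le) (use \<mu> \<nu> sets cond in auto)
  also have "\<dots> \<le> ennreal_sqrt (ennreal (2 * (1 + A) * (A * q)))"
    using cost by (rule ennreal_sqrt_mono)
  also have "\<dots> = ennreal (sqrt (2 * (1 + A) * (A * q)))"
    using \<open>A \<ge> 0\<close> \<open>q \<ge> 0\<close> by (intro ennreal_sqrt_ennreal) simp
  also have "sqrt (2 * (1 + A) * (A * q))
      = sqrt (2 * (1 + A) * A * (2 ^ CARD('d) + 1 / (a * r\<^sup>2))) * real n powr (- (1/8))"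
  proof -
    have "sqrt (real n powr (- (1/4))) = real n powr (- (1/8))"
      using \<open>n \<ge> 1\<close> by (simp add: powr_half_sqrt[symmetric] powr_powr)
    moreover have "2 * (1 + A) * (A * q)
        = (2 * (1 + A) * A * (2 ^ CARD('d) + 1 / (a * r\<^sup>2))) * real n powr (- (1/4))"
      by (simp add: q_def mult_ac)
    ultimately show ?thesis by (simp only: real_sqrt_mult)
  qed
  finally show ?thesis by (simp add: A_def)
qed

section \<open>Convergence rate of the penalized invariant measures\<close>

theorem theorem3p12:
  fixes D :: "(real ^ 'd) set"
    and \<sigma> m L R :: real
    and g :: "(real ^ 'd) \<Rightarrow> real"
    and G :: "(real ^ 'd) \<Rightarrow> (real ^ 'd)"
    and M :: "'w measure"
    and F :: "real \<Rightarrow> 'w measure"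
    and W :: "real \<Rightarrow> 'w \<Rightarrow> real ^ 'd"
    and \<pi> :: "(real ^ 'd) measure"
    and \<pi>n :: "nat \<Rightarrow> (real ^ 'd) measure"
  assumes D: "D \<noteq> {}" "closed D" "convex D"
    and sigma: "\<sigma> > 0"
    and C1: "C1_with_gradient g G"
    and A1: "m > 0" "strongly_convex m g G" "L-lipschitz_on UNIV G"
    and A2: "R > 0" "\<And>x. \<sigma>\<^sup>2 + (norm (G x))\<^sup>2 \<le> R * (1 + (norm x)\<^sup>2)"
    and W: "brownian_motion M F W"
    and well_posed: "reflected_well_posed M F W \<sigma> G D"
    and pi: "unique_invariant_probability M (reflected_solutions M F W \<sigma> G D) D \<pi>"
    and pi_Gibbs: "density_proportional_to \<pi> (\<lambda>x. exp (- (2 / \<sigma>\<^sup>2) * g x) * indicator D x)"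
    and pin: "\<And>n. n \<ge> 1 \<Longrightarrow>
          unique_invariant_probability M (penalized_solutions M F W \<sigma> G D n) UNIV (\<pi>n n)"
    and pin_Gibbs: "\<And>n. n \<ge> 1 \<Longrightarrow>
          density_proportional_to (\<pi>n n) (\<lambda>x. exp (- (2 / \<sigma>\<^sup>2) * penalized_potential g D n x))"
  shows "\<exists>C>0. \<exists>\<delta>>0. \<forall>n\<ge>1. wasserstein2 \<pi> (\<pi>n n) \<le> ennreal (C * real n powr (- \<delta>))"
proof -
  define \<beta> where "\<beta> = 2 / \<sigma>\<^sup>2"
  have "\<beta> > 0" using sigma by (simp add: \<beta>_def)
  define h where "h x = exp (- \<beta> * g x)" for x
  have "continuous_on UNIV g"
    using C1 unfolding C1_with_gradient_def gderiv_def
    by (auto intro!: continuous_at_imp_continuous_on has_derivative_continuous)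
  then have h_meas[measurable]: "h \<in> borel_measurable borel"
    unfolding h_def by (intro borel_measurable_continuous_onI continuous_intros)
  have [measurable]: "D \<in> sets borel" using D by auto
  obtain c where c: "c > 0" "\<pi> = density lborel (\<lambda>x. ennreal (c * (h x * indicator D x)))"
    using pi_Gibbs unfolding density_proportional_to_def h_def \<beta>_def by blast
  have prob_\<pi>: "prob_space \<pi>"
    using pi by (simp add: unique_invariant_probability_def invariant_probability_def)
  have "interior D \<noteq> {}"
    by (rule interior_nonempty_if_carries_density[OF D(3,2) prob_\<pi>[unfolded c(2)]]) auto
  then obtain z r where "r > 0" and ball: "ball z r \<subseteq> D"
    by (auto simp: mem_interior)
  obtain C where "C > 0" and
    h_le: "\<And>y. h y * (1 + (norm (y - z))\<^sup>2) \<le> C * exp (- (\<beta> * m / 4) * (norm (y - z))\<^sup>2)"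
    using strongly_convex_gibbs_le_gaussian[OF A1(2,1) \<open>\<beta> > 0\<close>, of z] unfolding h_def by blast
  have b: "\<beta> * m / 4 > 0" using \<open>\<beta> > 0\<close> A1(1) by simp
  obtain \<kappa> where "\<kappa> \<ge> 0"
    and \<kappa>: "(\<integral>\<^sup>+x. ennreal (exp (- (\<beta> * m / 4) * (norm (x - z))\<^sup>2)) \<partial>lborel) = ennreal \<kappa>"
    using nn_integral_gaussian_finite[OF b, of z] by (auto simp: less_top_ennreal)
  define B where "B = sqrt (2 * (1 + c * C * \<kappa>) * (c * C * \<kappa>) * (2 ^ CARD('d) + 1 / (\<beta> / 2 * r\<^sup>2)))"
  have "B \<ge> 0" using c \<open>C > 0\<close> \<open>\<kappa> \<ge> 0\<close> \<open>\<beta> > 0\<close> by (simp add: B_def)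
  \<comment> \<open>The summand \<open>1\<close> only serves to make the constant strictly positive.\<close>
  have "wasserstein2 \<pi> (\<pi>n n) \<le> ennreal ((B + 1) * real n powr (- (1/8)))" if "n \<ge> 1" for n
  proof -
    have prob: "prob_space (\<pi>n n)"
      using pin[OF that] by (simp add: unique_invariant_probability_def invariant_probability_def)
    have "exp (- (2 / \<sigma>\<^sup>2) * penalized_potential g D n x)
        = h x * exp (- (real n * (\<beta> / 2) * (infdist x D)\<^sup>2))" for x
      by (simp add: h_def \<beta>_def penalized_potential_def exp_add[symmetric] algebra_simps)
    then have "density_proportional_to (\<pi>n n) (\<lambda>x. h x * exp (- (real n * (\<beta> / 2) * (infdist x D)\<^sup>2)))"
      using pin_Gibbs[OF that] by presburger
    then obtain k where k: "k > 0"
      "\<pi>n n = density lborel (\<lambda>x. ennreal (k * (h x * exp (- (real n * (\<beta> / 2) * (infdist x D)\<^sup>2)))))"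
      unfolding density_proportional_to_def by blast
    have "wasserstein2 \<pi> (\<pi>n n) \<le> ennreal (B * real n powr (- (1/8)))"
      unfolding B_def
      by (rule wasserstein2_penalized_gibbs_le[OF D(2,3) ball \<open>r > 0\<close> b _ c(1) k(1) that h_meas _ h_le
            \<open>C > 0\<close> \<kappa> \<open>\<kappa> \<ge> 0\<close> c(2) prob_\<pi> k(2) prob])
         (use \<open>\<beta> > 0\<close> in \<open>auto simp: h_def\<close>)
    also have "\<dots> \<le> ennreal ((B + 1) * real n powr (- (1/8)))"
      by (intro ennreal_leI mult_right_mono) auto
    finally show ?thesis .
  qed
  then show ?thesis
    using \<open>B \<ge> 0\<close> by (intro exI[of _ "B + 1"] exI[of _ "1/8"] conjI) auto
qed

end
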